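(* Consider representations of a positive integer as $h-k$ with $h,k$ harmonic numbers. Then: (i) The only such representations of $3$ are $4-1$, $6-3$, $9-6$, $12-9$, and $27-24$. (ii) The only such representations of $7$ are $8-1$, $9-2$, and $16-9$. (iii) If $p\ge 5$ and $2^p-1$ is prime, then the only such representation of $2^p-1$ is $2^p-1$ itself (i.e. $h=2^p$, $k=1$).
   Context: A harmonic number is a positive integer of the form $2^a3^b$ with $a,b\ge 0$ integers (so $1$ is harmonic). A Mersenne prime is a prime of the form $2^p-1$. *)

theory Defs
  imports Complex_Main "HOL-Computational_Algebra.Primes"
begin

definition harmonic_number :: "nat \<Rightarrow> bool" where
  "harmonic_number n \<longleftrightarrow> (\<exists>a b. n = 2 ^ a * 3 ^ b)"

text \<open>The difference is taken in \<^typ>\<open>int\<close>, so that it is not truncated.\<close>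

definition difference_reps :: "nat \<Rightarrow> (nat \<times> nat) set" where
  "difference_reps n =
     {(h, k). harmonic_number h \<and> harmonic_number k \<and> int h - int k = int n}"

end

theory Submission
  imports Defs
begin

text \<open>
  If \<open>n\<close> is coprime to 6, then \<open>h\<close> and \<open>k\<close> are coprime in any representation \<open>n = h - k\<close>, so
  either \<open>k = 1\<close> or one of them is a power of 2 and the other a power of 3. The resulting
  exponential equations are solved by congruences. The decisive one is that \<open>3 ^ b = 1\<close> modulo 16
  forces 4 to divide \<open>b\<close>, hence \<open>3 ^ b = 1\<close> modulo 5, which then constrains the power of 2 involved.
  Representations of 3 are either coprime or 3 times a representation of 1.
\<close>

section \<open>Residues of powers of 2 and 3\<close>

lemma power_mod_period:
  fixes x m k n :: nat
  assumes "x ^ k mod m = 1"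
  shows "x ^ n mod m = x ^ (n mod k) mod m"
proof -
  have "x ^ n = (x ^ k) ^ (n div k) * x ^ (n mod k)"
    by (simp flip: power_mult power_add)
  also have "\<dots> mod m = ((x ^ k mod m) ^ (n div k) mod m) * x ^ (n mod k) mod m"
    by (simp add: power_mod mod_mult_left_eq)
  also have "\<dots> = x ^ (n mod k) mod m"
    unfolding assms by (simp add: mod_mult_left_eq)
  finally show ?thesis .
qed

lemma power2_mod3: "2 ^ n mod 3 = (if even n then 1 else 2 :: nat)"
proof -
  have "n mod 2 = 0 \<or> n mod 2 = 1" by auto
  then show ?thesis
    using power_mod_period[of 2 2 3 n] by (auto simp: even_iff_mod_2_eq_zero)
qed

lemma power2_mod5_eq_1: "2 ^ n mod 5 = (1::nat) \<Longrightarrow> even n"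
proof -
  assume *: "2 ^ n mod 5 = (1::nat)"
  have "n mod 4 = 0 \<or> n mod 4 = 1 \<or> n mod 4 = 2 \<or> n mod 4 = 3" by auto
  then have "n mod 4 = 0"
    using power_mod_period[of 2 4 5 n] * by (elim disjE) simp_all
  then show ?thesis by presburger
qed

lemma power3_mod8: "3 ^ n mod 8 = (if even n then 1 else 3 :: nat)"
proof -
  have "n mod 2 = 0 \<or> n mod 2 = 1" by auto
  then show ?thesis
    using power_mod_period[of 3 2 8 n] by (auto simp: even_iff_mod_2_eq_zero)
qed

text \<open>The order of 3 is 4 modulo 16 as well as modulo 5, so a residue 1 passes from one
  modulus to the other.\<close>

lemma power3_mod5_of_mod16:
  assumes "3 ^ n mod 16 = (1::nat)"
  shows "3 ^ n mod 5 = (1::nat)"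
proof -
  have "n mod 4 = 0 \<or> n mod 4 = 1 \<or> n mod 4 = 2 \<or> n mod 4 = 3" by auto
  then have "n mod 4 = 0"
    using power_mod_period[of 3 4 16 n] assms by (elim disjE) simp_all
  then show ?thesis
    using power_mod_period[of 3 4 5 n] by simp
qed

lemma not_5_dvd_power2: "\<not> 5 dvd (2::nat) ^ n"
proof
  assume "5 dvd (2::nat) ^ n"
  moreover have "prime (5::nat)" by simp
  ultimately have "5 dvd (2::nat)" using prime_dvd_power by blast
  then show False by simp
qed

lemma not_3_dvd_power2: "\<not> 3 dvd (2::nat) ^ n"
  using power2_mod3[of n] by (auto split: if_splits)

section \<open>Exponential equations in powers of 2 and 3\<close>

text \<open>If \<open>a >= 4\<close>, then \<open>3 ^ b\<close> is 1 modulo 16, hence modulo 5, and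
  5 would divide \<open>2 ^ a\<close>. The values 0 and 2 of \<open>a\<close> would give
  \<open>3 ^ b\<close> the residues 2 and 5 modulo 8, where only 1 and 3 occur.\<close>

lemma power3_eq_Suc_power2:
  fixes a b :: nat
  assumes "3 ^ b = 2 ^ a + (1::nat)"
  shows "a = 1 \<or> a = 3"
proof -
  have "a < 4"
  proof (rule ccontr)
    assume "\<not> a < 4"
    then obtain c where "a = 4 + c" using le_Suc_ex not_less by blast
    then have "3 ^ b = 16 * 2 ^ c + (1::nat)" using assms by (simp add: power_add)
    then have "3 ^ b mod 16 = (1::nat)" by simp
    then have "(2 ^ a + 1) mod 5 = (1::nat)" using power3_mod5_of_mod16 assms by metis
    then have "5 dvd (2::nat) ^ a" by presburger
    then show False using not_5_dvd_power2 by blast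
  qed
  moreover have "a \<noteq> 0"
    using assms power3_mod8[of b] by (cases "a = 0") (auto split: if_splits)
  moreover have "a \<noteq> 2"
    using assms power3_mod8[of b] by (cases "a = 2") (auto split: if_splits)
  ultimately show ?thesis by auto
qed

text \<open>Modulo 8, \<open>3 ^ b + 1\<close> is 2 or 4, so 8 cannot divide
  \<open>2 ^ a\<close>.\<close>

lemma power2_eq_Suc_power3:
  fixes a b :: nat
  assumes "2 ^ a = 3 ^ b + (1::nat)"
  shows "a = 1 \<or> a = 2"
proof -
  have "a < 3"
  proof (rule ccontr)
    assume "\<not> a < 3"
    then have "(2::nat) ^ 3 dvd 2 ^ a" by (intro le_imp_power_dvd) simp
    then have "(3 ^ b + 1) mod 8 = (0::nat)" using assms by simp
    then show False using power3_mod8[of b] by (auto split: if_splits) presburger+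
  qed
  moreover have "a \<noteq> 0" using assms by (cases "a = 0") auto
  ultimately show ?thesis by auto
qed

text \<open>Modulo 3 the exponent \<open>a\<close> is odd; modulo 8 it is less than 3. So
  \<open>a = 1\<close>, and the equation becomes \<open>3 ^ b = 2 ^ p + 1\<close>, which is already
  solved.\<close>

lemma power3_eq_power2_plus_mersenne:
  fixes a b p :: nat
  assumes p: "odd p" "p \<ge> 3" and eq: "3 ^ b = 2 ^ a + (2 ^ p - 1 :: nat)"
  shows "a = 1 \<and> p = 3"
proof -
  have p8: "(2::nat) ^ 3 dvd 2 ^ p" using p by (intro le_imp_power_dvd)
  have p1: "(1::nat) \<le> 2 ^ p" by simp
  have eq': "3 ^ b + 1 = 2 ^ a + (2 ^ p :: nat)" using eq p1 by linarith
  have b: "b \<noteq> 0"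
  proof
    assume "b = 0"
    moreover have "(2::nat) ^ p > 2 ^ 1" using p by (intro power_strict_increasing) auto
    ultimately show False using eq' by simp
  qed
  then have "3 dvd (3::nat) ^ b" by simp
  then have "(2 ^ a + 2 ^ p) mod 3 = (1::nat)"
    unfolding eq'[symmetric] by (auto elim!: dvdE)
  then have "odd a" using power2_mod3[of a] power2_mod3[of p] p(1)
    by (auto split: if_splits) presburger+
  have "a < 3"
  proof (rule ccontr)
    assume "\<not> a < 3"
    then have "(2::nat) ^ 3 dvd 2 ^ a" by (intro le_imp_power_dvd) simp
    then have "(3 ^ b + 1) mod 8 = (0::nat)" using p8 eq' by simp
    then show False using power3_mod8[of b] by (auto split: if_splits) presburger+
  qed
  with \<open>odd a\<close> have "a = 1" by (cases "a = 2") (auto elim: oddE)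
  then show ?thesis using power3_eq_Suc_power2[of b p] eq' p(2) by simp
qed

text \<open>The condition on \<open>b\<close> sets aside the solution \<open>a = p\<close>,
  \<open>b = 0\<close>, which exists for every \<open>p\<close>. Congruences then reduce to
  \<open>p = 3\<close>, where both exponents are even and the equation is a difference of
  squares.\<close>

lemma power2_eq_power3_plus_mersenne:
  fixes a b p :: nat
  assumes p: "odd p" "p \<ge> 3" and b: "b \<noteq> 0" and eq: "2 ^ a = 3 ^ b + (2 ^ p - 1 :: nat)"
  shows "p = 3 \<and> a = 4"
proof -
  have p1: "(1::nat) \<le> 2 ^ p" by simp
  have eq': "2 ^ a + 1 = 3 ^ b + (2 ^ p :: nat)" using eq p1 by linarith
  have "3 dvd (3::nat) ^ b" using b by simp
  then have "(2 ^ a + 1) mod 3 = 2 ^ p mod (3::nat)"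
    unfolding eq' by (auto elim!: dvdE)
  then have "even a" using power2_mod3[of a] power2_mod3[of p] p(1)
    by (auto split: if_splits) presburger+
  have "(3::nat) ^ b > 1" using b by (intro one_less_power) auto
  then have "(2::nat) ^ p < 2 ^ a" using eq' by linarith
  then have "p < a" by simp
  then obtain c where c: "a = p + c" using less_imp_add_positive by blast
  with \<open>even a\<close> p have "odd c" by simp
  \<comment> \<open>For \<open>p >= 4\<close>, 16 divides both powers of 2, so \<open>3 ^ b\<close>
    is 1 modulo 16 and hence modulo 5. Then 5 divides \<open>2 ^ a - 2 ^ p\<close>, so
    \<open>2 ^ c\<close> is 1 modulo 5, against \<open>c\<close> being odd.\<close>
  have "p = 3"
  proof (rule ccontr)
    assume "p \<noteq> 3"
    then have "(2::nat) ^ 4 dvd 2 ^ p" using p(2) by (intro le_imp_power_dvd) simp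
    moreover have "(2::nat) ^ 4 dvd 2 ^ a" using p(2) \<open>p < a\<close> by (intro le_imp_power_dvd) simp
    ultimately obtain u v where "2 ^ p = 16 * (u::nat)" "2 ^ a = 16 * (v::nat)" by (auto elim!: dvdE)
    with eq' have "(3 ^ b + 16 * u) mod 16 = (1 + 16 * v) mod 16" by simp
    then have "3 ^ b mod 16 = (1::nat)" by simp
    then have "3 ^ b mod 5 = (1::nat)" by (rule power3_mod5_of_mod16)
    then obtain q :: nat where "3 ^ b = 5 * q + 1" by (metis mult_div_mod_eq)
    then have "2 ^ a = 5 * q + 2 ^ p" using eq' by simp
    then have "5 dvd (2::nat) ^ a - 2 ^ p" by simp
    moreover have "(2::nat) ^ a - 2 ^ p = 2 ^ p * (2 ^ c - 1)"
      by (simp add: c power_add algebra_simps)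
    moreover have "prime (5::nat)" by simp
    ultimately have "5 dvd (2::nat) ^ c - 1"
      using not_5_dvd_power2 prime_dvd_multD by metis
    moreover have "(1::nat) \<le> 2 ^ c" by simp
    ultimately have "2 ^ c mod 5 = (1::nat)" by presburger
    then show False using power2_mod5_eq_1 \<open>odd c\<close> by blast
  qed
  then have eq7: "2 ^ a = 3 ^ b + (7::nat)" using eq by simp
  \<comment> \<open>Modulo 8 the equation says that \<open>3 ^ b\<close> is 1.\<close>
  have "even b"
  proof -
    have "(2::nat) ^ 3 dvd 2 ^ a" using p(2) \<open>p < a\<close> by (intro le_imp_power_dvd) simp
    then have "(3 ^ b + 7) mod 8 = (0::nat)" using eq7 by simp
    then show ?thesis using power3_mod8[of b] by (auto split: if_splits) presburger
  qed
  with \<open>even a\<close> obtain x y where x: "a = 2 * x" and y: "b = 2 * y" by (auto elim!: evenE)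
  have xy: "(2 ^ x) ^ 2 = (3 ^ y) ^ 2 + (7::nat)"
    using eq7 unfolding x y power_even_eq .
  have "(3::nat) ^ y < 2 ^ x"
  proof (rule power_less_imp_less_base)
    show "((3::nat) ^ y) ^ 2 < (2 ^ x) ^ 2" using xy by linarith
  qed simp
  then obtain d where d: "2 ^ x = 3 ^ y + d" "d > (0::nat)"
    using less_imp_add_positive by metis
  \<comment> \<open>difference of two squares: \<open>d\<close> and \<open>2 * 3 ^ y + d\<close> are complementary divisors of 7\<close>
  have d7: "d * (2 * 3 ^ y + d) = 7"
    using xy unfolding d(1) by (simp add: power2_eq_square algebra_simps)
  then have "prime (d * (2 * 3 ^ y + d))" by simp
  then have "d = 1 \<or> 2 * 3 ^ y + d = 1" by (rule prime_product)
  moreover have "2 * 3 ^ y + d \<noteq> 1" using d(2) zero_less_power[of "3::nat" y] by linarith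
  ultimately have "d = 1" by blast
  moreover from this d7 have "3 ^ y = (3::nat)" by simp
  ultimately have "(2::nat) ^ x = 2 ^ 2" using d(1) by simp
  then have "x = 2" by (subst (asm) power_inject_exp) auto
  then show ?thesis using x \<open>p = 3\<close> by simp
qed

section \<open>Representations as differences of harmonic numbers\<close>

lemma mem_difference_reps:
  "(h, k) \<in> difference_reps n \<longleftrightarrow> harmonic_number h \<and> harmonic_number k \<and> h = k + n"
  unfolding difference_reps_def by auto

text \<open>Neither 2 nor 3 can divide both \<open>h\<close> and \<open>k\<close>, since it would
  divide \<open>n\<close>; so each prime occurs in at most one of them. The condition
  \<open>b \<noteq> 0\<close> keeps \<open>k = 1\<close> out of the second case.\<close>

lemma difference_reps_coprime_6:
  assumes hk: "(h, k) \<in> difference_reps n" and n: "odd n" "\<not> 3 dvd n"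
  obtains "k = 1" "h = Suc n"
    | a b where "h = 2 ^ a" "k = 3 ^ b" "b \<noteq> 0" "2 ^ a = 3 ^ b + n"
    | a b where "h = 3 ^ b" "k = 2 ^ a" "3 ^ b = 2 ^ a + n"
proof -
  from hk obtain a b c d where h: "h = 2 ^ a * 3 ^ b" and k: "k = 2 ^ c * 3 ^ d"
    and eq: "h = k + n"
    unfolding mem_difference_reps harmonic_number_def by blast
  have "a = 0 \<or> c = 0"
  proof (rule ccontr)
    assume "\<not> (a = 0 \<or> c = 0)"
    then have "even h" "even k" by (auto simp: h k)
    then show False using eq n(1) by simp
  qed
  moreover have "b = 0 \<or> d = 0"
  proof (rule ccontr)
    assume "\<not> (b = 0 \<or> d = 0)"
    then have "3 dvd h" "3 dvd k" by (auto simp: h k)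
    then show False using eq n(2) by presburger
  qed
  \<comment> \<open>Positivity of \<open>n\<close> and \<open>k\<close> excludes
    \<open>h = 1\<close>, the remaining combination of vanishing exponents.\<close>
  moreover have "n \<noteq> 0" using n(1) by (cases "n = 0") auto
  moreover have "k \<noteq> 0" by (simp add: k)
  ultimately consider "c = 0" "d = 0" | "b = 0" "c = 0" "d \<noteq> 0" | "a = 0" "d = 0"
    using h eq by fastforce
  then show thesis
  proof cases
    case 1
    then show ?thesis using that(1) k eq by simp
  next
    case 2
    then show ?thesis using that(2)[of a d] h k eq by simp
  next
    case 3
    then show ?thesis using that(3)[of b c] h k eq by simp
  qed
qed

text \<open>These are the numbers occurring in the listed representations of 3 and 7.\<close>

lemma harmonic_number_numerals:
  "harmonic_number 1" "harmonic_number 2" "harmonic_number 3" "harmonic_number 4"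
  "harmonic_number 6" "harmonic_number 8" "harmonic_number 9" "harmonic_number 12"
  "harmonic_number 16" "harmonic_number 24" "harmonic_number 27"
proof -
  have *: "harmonic_number (2 ^ a * 3 ^ b)" for a b
    unfolding harmonic_number_def by blast
  show "harmonic_number 1" "harmonic_number 2" "harmonic_number 3" "harmonic_number 4"
    "harmonic_number 6" "harmonic_number 8" "harmonic_number 9" "harmonic_number 12"
    "harmonic_number 16" "harmonic_number 24" "harmonic_number 27"
    using *[of 0 0] *[of 1 0] *[of 0 1] *[of 2 0] *[of 1 1] *[of 3 0] *[of 0 2] *[of 2 1]
      *[of 4 0] *[of 3 1] *[of 0 3] by simp_all
qed

lemma harmonic_number_power2: "harmonic_number (2 ^ p)"
  unfolding harmonic_number_def by (metis mult_1_right power_0)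

text \<open>An upper bound suffices: tripling these pairs yields the non-coprime representations of
  3.\<close>

lemma difference_reps_1:
  "difference_reps 1 \<subseteq> {(2, 1), (3, 2), (4, 3), (9, 8)}"
proof (intro subrelI)
  fix h k
  assume "(h, k) \<in> difference_reps 1"
  then show "(h, k) \<in> {(2, 1), (3, 2), (4, 3), (9, 8)}"
  proof (rule difference_reps_coprime_6)
    fix a b :: nat
    assume h: "h = 2 ^ a" and k: "k = 3 ^ b" and eq: "2 ^ a = 3 ^ b + (1::nat)"
    then have "h = k + 1" by simp
    moreover have "h = 2 \<or> h = 4" using power2_eq_Suc_power3[OF eq] h by auto
    ultimately show "(h, k) \<in> {(2, 1), (3, 2), (4, 3), (9, 8)}" by auto
  next
    fix a b :: nat
    assume "h = 3 ^ b" "k = 2 ^ a" "3 ^ b = 2 ^ a + (1::nat)"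
    then have "h = k + 1" "k = 2 \<or> k = 8"
      using power3_eq_Suc_power2[of b a] by auto
    then show "(h, k) \<in> {(2, 1), (3, 2), (4, 3), (9, 8)}" by auto
  qed simp_all
qed

text \<open>Either 3 divides both \<open>h\<close> and \<open>k\<close>, and dividing by it leaves a
  representation of 1, or it divides neither and both are powers of 2.\<close>

lemma difference_reps_3:
  "difference_reps 3 = {(4, 1), (6, 3), (9, 6), (12, 9), (27, 24)}"
proof
  show "difference_reps 3 \<subseteq> {(4, 1), (6, 3), (9, 6), (12, 9), (27, 24)}"
  proof (intro subrelI)
    fix h k
    assume "(h, k) \<in> difference_reps 3"
    then obtain a b c d where h: "h = 2 ^ a * 3 ^ b" and k: "k = 2 ^ c * 3 ^ d"
      and eq: "h = k + 3"
      unfolding mem_difference_reps harmonic_number_def by blast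
    have 3: "3 dvd h \<longleftrightarrow> 3 dvd k" using eq by presburger
    have "3 dvd (2::nat) ^ i * 3 ^ j \<longleftrightarrow> j \<noteq> 0" for i j
      by (cases j) (auto simp: not_3_dvd_power2)
    with 3 have bd: "b = 0 \<longleftrightarrow> d = 0" by (auto simp: h k)
    show "(h, k) \<in> {(4, 1), (6, 3), (9, 6), (12, 9), (27, 24)}"
    proof (cases "b = 0")
      case True
      with bd have eq': "2 ^ a = 2 ^ c + (3::nat)" using h k eq by simp
      then have "a \<noteq> 0" by (cases "a = 0") auto
      then have "even ((2::nat) ^ a)" by simp
      \<comment> \<open>An even \<open>2 ^ c + 3\<close> needs an odd \<open>2 ^ c\<close>.\<close>
      then have "c = 0" unfolding eq' by (cases c) auto
      then show ?thesis using True bd h k eq by simp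
    next
      case False
      with bd obtain b' d' where "b = Suc b'" "d = Suc d'" by (metis not0_implies_Suc)
      then obtain x y where hk: "h = 3 * x" "k = 3 * y"
        and "x = 2 ^ a * 3 ^ b'" "y = 2 ^ c * 3 ^ d'" using h k by auto
      with eq have "(x, y) \<in> difference_reps 1"
        unfolding mem_difference_reps harmonic_number_def by auto
      then have "(x, y) \<in> {(2, 1), (3, 2), (4, 3), (9, 8)}"
        by (rule subsetD[OF difference_reps_1])
      then show ?thesis unfolding hk by auto
    qed
  qed
qed (use harmonic_number_numerals in \<open>auto simp: mem_difference_reps\<close>)

text \<open>For odd \<open>p\<close>, \<open>2 ^ p - 1\<close> is odd and 1 modulo 3, so the coprime
  case split applies. Both 7 and the larger Mersenne primes are covered.\<close>

lemma difference_reps_mersenne: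
  assumes p: "odd p" "p \<ge> 3" and hk: "(h, k) \<in> difference_reps (2 ^ p - 1)"
  shows "(h, k) = (2 ^ p, 1) \<or> p = 3 \<and> (h, k) \<in> {(9, 2), (16, 9)}"
proof -
  have "odd (2 ^ p - 1 :: nat)" using p by auto
  moreover have "2 ^ p mod 3 = (2::nat)" using power2_mod3[of p] p(1) by simp
  then have "\<not> 3 dvd (2 ^ p - 1 :: nat)" by presburger
  ultimately show ?thesis
  proof (rule difference_reps_coprime_6[OF hk])
    fix a b :: nat
    assume a: "h = 2 ^ a" "k = 3 ^ b" "b \<noteq> 0" "2 ^ a = 3 ^ b + (2 ^ p - 1 :: nat)"
    then have "p = 3" "a = 4" using power2_eq_power3_plus_mersenne[of p b a] p by auto
    with a show ?thesis by auto
  next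
    fix a b :: nat
    assume b: "h = 3 ^ b" "k = 2 ^ a" "3 ^ b = 2 ^ a + (2 ^ p - 1 :: nat)"
    then have "p = 3" "a = 1" using power3_eq_power2_plus_mersenne[of p b a] p by auto
    with b show ?thesis by auto
  qed simp
qed

lemma difference_reps_7: "difference_reps 7 = {(8, 1), (9, 2), (16, 9)}"
proof
  show "difference_reps 7 \<subseteq> {(8, 1), (9, 2), (16, 9)}"
    using difference_reps_mersenne[of 3] by auto
qed (use harmonic_number_numerals in \<open>auto simp: mem_difference_reps\<close>)

text \<open>For even \<open>p\<close>, 3 divides \<open>2 ^ p - 1\<close>, so the prime would be 3,
  yet it is at least 7.\<close>

lemma odd_exponent_if_mersenne_prime:
  assumes "prime (2 ^ p - 1 :: nat)" "p \<ge> 3"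
  shows "odd p"
proof
  assume "even p"
  then have "2 ^ p mod 3 = (1::nat)" by (simp add: power2_mod3)
  then have "3 dvd (2 ^ p - 1 :: nat)" by presburger
  then have "2 ^ p - 1 = (3::nat)" using assms(1) primes_dvd_imp_eq[of 3 "2 ^ p - 1 :: nat"] by simp
  moreover have "(2::nat) ^ 3 \<le> 2 ^ p" using assms(2) by (intro power_increasing) auto
  ultimately show False by simp
qed

theorem theorem3p1:
  shows "difference_reps 3 = {(4, 1), (6, 3), (9, 6), (12, 9), (27, 24)} \<and>
    difference_reps 7 = {(8, 1), (9, 2), (16, 9)} \<and>
    (\<forall>p::nat. p \<ge> 5 \<and> prime (2 ^ p - 1 :: nat) \<longrightarrow>
       difference_reps (2 ^ p - 1) = {(2 ^ p, 1)})"
proof (intro conjI allI impI difference_reps_3 difference_reps_7)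
  fix p :: nat
  assume p: "p \<ge> 5 \<and> prime (2 ^ p - 1 :: nat)"
  then have "odd p" using odd_exponent_if_mersenne_prime by simp
  then have "difference_reps (2 ^ p - 1) \<subseteq> {(2 ^ p, 1)}"
    using difference_reps_mersenne[of p] p by auto
  moreover have "(2 ^ p, 1) \<in> difference_reps (2 ^ p - 1)"
    using harmonic_number_power2 harmonic_number_numerals(1) by (simp add: mem_difference_reps)
  ultimately show "difference_reps (2 ^ p - 1) = {(2 ^ p, 1)}" by blast
qed

end
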